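(* Let $P$ be the condensation measure on $\mathbb{R}$ satisfying $P=\frac13 P\circ S_1^{-1}+\frac13 P\circ S_2^{-1}+\frac13\nu$, with $S_1(x)=\frac15x$, $S_2(x)=\frac15x+\frac45$, where $\nu$ is the self-similar probability measure satisfying $\nu=\frac12\nu\circ T_1^{-1}+\frac12\nu\circ T_2^{-1}$ with $T_1(x)=\frac17x+\frac{12}{35}$, $T_2(x)=\frac17x+\frac{18}{35}$. Let $\kappa=\frac{2\log2}{\log75-\log2}$, the unique number with $\left(\frac13\left(\frac15\right)^2\right)^{\frac{\kappa}{2+\kappa}}=\frac12$. Then $D(P)=\lim_{n\to\infty}\frac{2\log n}{-\log V_n(P)}=\kappa$; that is, the quantization dimension of $P$ exists and is equal to $\kappa$.
   Context: For a Borel probability measure $\mu$ on $\mathbb{R}$ with compact support, $V_n(\mu)=\inf\{\int\min_{a\in\alpha}(x-a)^2\,d\mu(x):\alpha\subset\mathbb{R},\ 1\le\mathrm{card}(\alpha)\le n\}$ is the $n$th quantization error, and the quantization dimension is $D(\mu)=\lim_{n\to\infty}\frac{2\log n}{-\log V_n(\mu)}$ if the limit exists. The measures $\nu$ and $P$ are the unique compactly supported Borel probability measures satisfying the displayed identities. *)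

theory Defs
  imports "HOL-Probability.Probability"
begin

definition measure_support :: "real measure \<Rightarrow> real set" where
  "measure_support \<mu> = {x. \<forall>U. open U \<longrightarrow> x \<in> U \<longrightarrow> emeasure \<mu> U > 0}"

definition compactly_supported_distribution :: "real measure \<Rightarrow> bool" where
  "compactly_supported_distribution \<mu> \<longleftrightarrow> real_distribution \<mu> \<and> compact (measure_support \<mu>)"

(* The integral is the Bochner integral, so this is meaningful only when the integrand is
   integrable, as it is for compactly supported distributions; likewise only for n >= 1, since
   for n = 0 the infimum ranges over the empty set. *)
definition quantization_error :: "real measure \<Rightarrow> nat \<Rightarrow> real" where
  "quantization_error \<mu> n =
     Inf {(\<integral>x. Min ((\<lambda>a. (x - a)\<^sup>2) ` \<alpha>) \<partial>\<mu>) | \<alpha>. finite \<alpha> \<and> 1 \<le> card \<alpha> \<and> card \<alpha> \<le> n}"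

definition quantization_quotient :: "real measure \<Rightarrow> nat \<Rightarrow> real" where
  "quantization_quotient \<mu> n = 2 * ln (real n) / (- ln (quantization_error \<mu> n))"

(* An unspecified value if the limit does not exist. *)
definition quantization_dimension :: "real measure \<Rightarrow> real" where
  "quantization_dimension \<mu> = lim (quantization_quotient \<mu>)"

definition S1 :: "real \<Rightarrow> real" where "S1 x = 1/5 * x"
definition S2 :: "real \<Rightarrow> real" where "S2 x = 1/5 * x + 4/5"
definition T1 :: "real \<Rightarrow> real" where "T1 x = 1/7 * x + 12/35"
definition T2 :: "real \<Rightarrow> real" where "T2 x = 1/7 * x + 18/35"

end

theory Submission
  imports Defs "HOL-Real_Asymp.Real_Asymp"
begin

text \<open>Since the scaling of \<open>\<nu>\<close> is stronger than that of \<open>P\<close>, only the maps \<open>S\<^sub>1\<close> and \<open>S\<^sub>2\<close> matter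
  on the logarithmic scale. For the upper bound, put \<open>A\<^sub>m = S\<^sub>1(A\<^sub>m\<^sub>-\<^sub>1) \<union> S\<^sub>2(A\<^sub>m\<^sub>-\<^sub>1) \<union> B\<^sub>m\<close>, where
  \<open>B\<^sub>m\<close> has \<open>2\<^sup>m\<close> points and \<open>\<nu>\<close>-error at most \<open>49\<^sup>-\<^sup>m\<close>: this set has at most \<open>(m + 1) 2\<^sup>m\<close> points, and
  its \<open>P\<close>-error is \<open>O((2/75)\<^sup>m)\<close> because \<open>1/49 < 2/75\<close>. For the lower bound, drop \<open>\<nu>\<close> and split \<open>A\<close>
  at \<open>1/2\<close>: each point helps only one of the two halves, so by self-similarity the truncated error is
  at least \<open>(2\<^sup>m - |A|) / (25 75\<^sup>m)\<close>. Taking \<open>2\<^sup>m\<close> comparable with \<open>2n\<close> gives the matching exponent.\<close>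

section \<open>Measures with a mixture identity\<close>

text \<open>Both sides are additive and homogeneous in \<open>f\<close> and continuous along
  increasing sequences, so the identity spreads from indicators to all measurable
  \<open>f\<close>.\<close>

lemma nn_integral_mixture:
  assumes sets [simp]: "sets N1 = sets M" "sets N2 = sets M" "sets N3 = sets M"
    and mix: "\<And>A. A \<in> sets M \<Longrightarrow>
      emeasure M A = a * emeasure N1 A + b * emeasure N2 A + c * emeasure N3 A"
    and f: "f \<in> borel_measurable M"
  shows "(\<integral>\<^sup>+x. f x \<partial>M) =
    a * (\<integral>\<^sup>+x. f x \<partial>N1) + b * (\<integral>\<^sup>+x. f x \<partial>N2) + c * (\<integral>\<^sup>+x. f x \<partial>N3)"
  using f
proof (induction rule: borel_measurable_induct)
  case (cong f g)
  have "(\<integral>\<^sup>+x. f x \<partial>N) = (\<integral>\<^sup>+x. g x \<partial>N)" if "sets N = sets M" for N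
    by (rule nn_integral_cong) (simp add: cong.hyps(3) sets_eq_imp_space_eq[OF that])
  then show ?case using cong.IH by simp
next
  case (set A)
  then show ?case by (simp add: mix)
next
  case (mult u d)
  have "u \<in> borel_measurable N" if "sets N = sets M" for N
    using mult.hyps(2) that by (simp cong: measurable_cong_sets)
  then have "(\<integral>\<^sup>+x. d * u x \<partial>N) = d * (\<integral>\<^sup>+x. u x \<partial>N)" if "sets N = sets M" for N
    using that by (intro nn_integral_cmult) auto
  then show ?case using mult.IH by (simp add: distrib_left mult.left_commute)
next
  case (add u v)
  have "u \<in> borel_measurable N" "v \<in> borel_measurable N" if "sets N = sets M" for N
    using add.hyps that by (simp_all cong: measurable_cong_sets)
  then have "(\<integral>\<^sup>+x. v x + u x \<partial>N) = (\<integral>\<^sup>+x. v x \<partial>N) + (\<integral>\<^sup>+x. u x \<partial>N)" if "sets N = sets M" for N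
    using that by (intro nn_integral_add) auto
  then show ?case using add.IH by (simp add: distrib_left add_ac)
next
  case (seq U)
  have "U i \<in> borel_measurable N" if "sets N = sets M" for N i
    using seq.hyps(1) that by (simp cong: measurable_cong_sets)
  then have sup: "(\<integral>\<^sup>+x. (SUP i. U i) x \<partial>N) = (SUP i. \<integral>\<^sup>+x. U i x \<partial>N)" if "sets N = sets M" for N
    using that seq.hyps(3) by (simp only: SUP_apply) (intro nn_integral_monotone_convergence_SUP; auto)
  have inc: "incseq (\<lambda>i. d * (\<integral>\<^sup>+x. U i x \<partial>N))" for d N
    using seq.hyps(3) by (auto simp: incseq_def le_fun_def intro!: mult_left_mono nn_integral_mono)
  show ?case
    unfolding sup[OF refl] sup[OF sets(1)] sup[OF sets(2)] sup[OF sets(3)] seq.IH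
    by (simp add: ennreal_SUP_add inc incseq_def SUP_mult_left_ennreal
        add_mono[OF incseqD[OF inc] incseqD[OF inc]])
qed

text \<open>The complement of the support is the union of all open null sets, and by Lindelof
  countably many of them already cover it.\<close>

lemma AE_measure_support:
  fixes \<mu> :: "real measure"
  assumes "sets \<mu> = sets borel"
  shows "AE x in \<mu>. x \<in> measure_support \<mu>"
proof -
  define F where "F = {U. open U \<and> emeasure \<mu> U = 0}"
  obtain F' where F': "F' \<subseteq> F" "countable F'" "\<Union>F' = \<Union>F"
    using Lindelof[of F] by (auto simp: F_def)
  have "\<Union>F' \<in> null_sets \<mu>"
  proof (rule null_sets_UN'[of F' id, simplified])
    show "countable F'" by fact
    show "U \<in> null_sets \<mu>" if "U \<in> F'" for U
      using that F'(1) assms by (auto simp: F_def null_sets_def)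
  qed
  moreover have "{x \<in> space \<mu>. x \<notin> measure_support \<mu>} \<subseteq> \<Union>F'"
    unfolding F'(3) by (auto simp: measure_support_def F_def)
  ultimately show ?thesis by (rule AE_I')
qed

text \<open>A continuous \<open>h\<close> is bounded on the unit interval. The inner map
  \<open>f\<close> lets one statement serve both a measure and its affine images.\<close>

lemma integrable_unit:
  fixes h :: "real \<Rightarrow> real"
  assumes "finite_measure N" "AE x in N. f x \<in> {0..1}" "f \<in> borel_measurable N"
    and h: "continuous_on UNIV h"
  shows "integrable N (\<lambda>x. h (f x))"
proof -
  interpret finite_measure N by fact
  have "bounded (h ` {0..1})"
    by (intro compact_imp_bounded compact_continuous_image continuous_on_subset[OF h]) auto
  then obtain B where B: "\<forall>x\<in>{0..1}. norm (h x) \<le> B"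
    unfolding bounded_iff by auto
  have [measurable]: "h \<in> borel_measurable borel"
    using h by (rule borel_measurable_continuous_onI)
  show ?thesis
    using assms(3)
    by (intro integrable_const_bound[where B=B] eventually_mono[OF assms(2)]) (use B in auto)
qed

text \<open>One setting for both measures: \<open>v = 0\<close> gives the purely self-similar
  \<open>\<nu>\<close>, \<open>v = 1/3\<close> the condensation measure \<open>P\<close>. The bounds
  on \<open>s\<close> and \<open>t\<close> say that both maps send the unit interval into
  itself.\<close>

locale condensation = real_distribution \<mu> + \<rho>: real_distribution \<rho>
  for \<mu> \<rho> :: "real measure" +
  fixes r s t w v :: real
  assumes r: "0 < r" "r < 1"
    and s: "0 \<le> s" "s \<le> 1 - r"
    and t: "0 \<le> t" "t \<le> 1 - r"
    and w: "0 \<le> w" and v: "0 \<le> v"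
    and self_similar: "\<And>A. A \<in> sets borel \<Longrightarrow>
      measure \<mu> A = w * measure (distr \<mu> borel (\<lambda>x. r * x + s)) A
        + w * measure (distr \<mu> borel (\<lambda>x. r * x + t)) A + v * measure \<rho> A"
    and compact_support: "compact (measure_support \<mu>)"
    and condensed_unit: "AE x in \<rho>. x \<in> {0..1}"
begin

section \<open>Concentration on the unit interval and the self-similar integral identity\<close>

lemma emeasure_self_similar:
  assumes "A \<in> sets borel"
  shows "emeasure \<mu> A = ennreal w * emeasure (distr \<mu> borel (\<lambda>x. r * x + s)) A
    + ennreal w * emeasure (distr \<mu> borel (\<lambda>x. r * x + t)) A + ennreal v * emeasure \<rho> A"
proof -
  interpret D1: prob_space "distr \<mu> borel (\<lambda>x. r * x + s)" by (rule prob_space_distr) simp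
  interpret D2: prob_space "distr \<mu> borel (\<lambda>x. r * x + t)" by (rule prob_space_distr) simp
  show ?thesis
    using self_similar[OF assms] w v
    by (simp add: emeasure_eq_measure D1.emeasure_eq_measure D2.emeasure_eq_measure
        \<rho>.emeasure_eq_measure flip: ennreal_mult ennreal_plus)
qed

lemma AE_self_similar:
  assumes "closed C" "AE x in \<mu>. r * x + s \<in> C" "AE x in \<mu>. r * x + t \<in> C" "AE x in \<rho>. x \<in> C"
  shows "AE x in \<mu>. x \<in> C"
proof -
  have C: "- C \<in> sets borel" using assms(1) by (intro borel_open) auto
  have ae: "(AE x in N. x \<in> C) \<longleftrightarrow> emeasure N (- C) = 0" if "sets N = sets borel" for N
    using C that sets_eq_imp_space_eq[OF that]
    by (subst AE_iff_measurable[where N="- C"]) auto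
  have Cs: "{x \<in> space borel. x \<in> C} \<in> sets borel"
    using assms(1) by (auto intro: borel_closed)
  have "AE x in distr \<mu> borel (\<lambda>x. r * x + u). x \<in> C" if "AE x in \<mu>. r * x + u \<in> C" for u
    using that Cs by (subst AE_distr_iff) auto
  then show ?thesis
    using assms(2-4) by (simp add: ae emeasure_self_similar C)
qed

text \<open>Compact support places \<open>\<mu>\<close> in some \<open>{- B..1 + B}\<close>. Each
  use of self-similarity shrinks the excess by the factor \<open>r\<close>, and the intervals for
  all \<open>k\<close> intersect in the unit interval.\<close>

lemma AE_unit: "AE x in \<mu>. x \<in> {0..1}"
proof -
  obtain R where R: "\<And>x. x \<in> measure_support \<mu> \<Longrightarrow> \<bar>x\<bar> \<le> R"
    using compact_imp_bounded[OF compact_support] by (auto simp: bounded_iff)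
  \<comment> \<open>\<open>R\<close> could be negative if the support were empty;
    \<open>0 \<le> B\<close> keeps the unit interval, which carries \<open>\<rho>\<close>, inside
    every interval below.\<close>
  define B where "B = max R 0"
  have "AE x in \<mu>. x \<in> {- (r ^ k * B)..1 + r ^ k * B}" for k
  proof (induction k)
    case 0
    show ?case
      using AE_measure_support[OF events_eq_borel]
      by eventually_elim (use R in \<open>force simp: B_def abs_le_iff\<close>)
  next
    case (Suc k)
    have step: "r * x + u \<in> {- (r ^ Suc k * B)..1 + r ^ Suc k * B}"
      if "x \<in> {- (r ^ k * B)..1 + r ^ k * B}" "0 \<le> u" "u \<le> 1 - r" for x u
    proof -
      have "r * (- (r ^ k * B)) \<le> r * x" "r * x \<le> r * (1 + r ^ k * B)"
        using that(1) r by (intro mult_left_mono; simp)+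
      then show ?thesis using that(2,3) by (simp add: algebra_simps)
    qed
    show ?case
    proof (rule AE_self_similar)
      show "AE x in \<mu>. r * x + s \<in> {- (r ^ Suc k * B)..1 + r ^ Suc k * B}"
        using Suc by eventually_elim (use step s in blast)
      show "AE x in \<mu>. r * x + t \<in> {- (r ^ Suc k * B)..1 + r ^ Suc k * B}"
        using Suc by eventually_elim (use step t in blast)
      have "0 \<le> r ^ Suc k * B" using r by (simp add: B_def)
      then show "AE x in \<rho>. x \<in> {- (r ^ Suc k * B)..1 + r ^ Suc k * B}"
        by (intro eventually_mono[OF condensed_unit]) auto
    qed simp
  qed
  then have ae: "AE x in \<mu>. \<forall>k. x \<in> {- (r ^ k * B)..1 + r ^ k * B}"
    by (simp add: AE_all_countable)
  have "(\<lambda>k. r ^ k * B) \<longlonglongrightarrow> 0 * B"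
    using r by (intro tendsto_intros LIMSEQ_realpow_zero) auto
  then have lim: "(\<lambda>k. - (r ^ k * B)) \<longlonglongrightarrow> 0" "(\<lambda>k. 1 + r ^ k * B) \<longlonglongrightarrow> 1"
    using tendsto_minus[of "\<lambda>k. r ^ k * B" 0] tendsto_add[OF tendsto_const[of 1], of "\<lambda>k. r ^ k * B" 0]
    by simp_all
  show ?thesis
    by (rule eventually_mono[OF ae]) (use LIMSEQ_le_const2[OF lim(1)] LIMSEQ_le_const[OF lim(2)] in auto)
qed

lemma AE_affine_unit:
  assumes "0 \<le> u" "u \<le> 1 - r"
  shows "AE x in \<mu>. r * x + u \<in> {0..1}"
  using AE_unit
proof eventually_elim
  case (elim x)
  then have "0 \<le> r * x" "r * x \<le> r * 1" using r by (auto intro: mult_left_mono)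
  then show ?case using assms by auto
qed

text \<open>Nonnegativity gives access to the mixture identity for \<open>nn_integral\<close>; as
  all arguments lie almost surely in the unit interval, every term is finite and can be turned back
  into a Bochner integral.\<close>

lemma integral_self_similar:
  fixes h :: "real \<Rightarrow> real"
  assumes h: "continuous_on UNIV h" and nonneg: "\<And>x. 0 \<le> h x"
  shows "(\<integral>x. h x \<partial>\<mu>) =
    w * (\<integral>x. h (r * x + s) \<partial>\<mu>) + w * (\<integral>x. h (r * x + t) \<partial>\<mu>) + v * (\<integral>x. h x \<partial>\<rho>)"
proof -
  have h_meas [measurable]: "h \<in> borel_measurable borel"
    using h by (rule borel_measurable_continuous_onI)
  have nn: "(\<integral>\<^sup>+x. ennreal (h (f x)) \<partial>N) = ennreal (\<integral>x. h (f x) \<partial>N)"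
    if "finite_measure N" "AE x in N. f x \<in> {0..1}" "f \<in> borel_measurable N" for N f
    using integrable_unit[OF that h] by (rule nn_integral_eq_integral) (simp add: nonneg)
  have "(\<integral>\<^sup>+x. h x \<partial>\<mu>) = ennreal w * (\<integral>\<^sup>+x. h x \<partial>distr \<mu> borel (\<lambda>x. r * x + s))
      + ennreal w * (\<integral>\<^sup>+x. h x \<partial>distr \<mu> borel (\<lambda>x. r * x + t)) + ennreal v * (\<integral>\<^sup>+x. h x \<partial>\<rho>)"
    by (rule nn_integral_mixture) (simp_all add: emeasure_self_similar)
  also have "\<dots> = ennreal w * (\<integral>\<^sup>+x. h (r * x + s) \<partial>\<mu>)
      + ennreal w * (\<integral>\<^sup>+x. h (r * x + t) \<partial>\<mu>) + ennreal v * (\<integral>\<^sup>+x. h x \<partial>\<rho>)"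
    by (simp add: nn_integral_distr)
  also have "(\<integral>\<^sup>+x. h (r * x + s) \<partial>\<mu>) = ennreal (\<integral>x. h (r * x + s) \<partial>\<mu>)"
    using s by (intro nn AE_affine_unit) (auto intro: finite_measure_axioms)
  also have "(\<integral>\<^sup>+x. h (r * x + t) \<partial>\<mu>) = ennreal (\<integral>x. h (r * x + t) \<partial>\<mu>)"
    using t by (intro nn AE_affine_unit) (auto intro: finite_measure_axioms)
  also have "(\<integral>\<^sup>+x. h x \<partial>\<rho>) = ennreal (\<integral>x. h x \<partial>\<rho>)"
    by (intro nn condensed_unit \<rho>.finite_measure_axioms) simp
  also have "(\<integral>\<^sup>+x. h x \<partial>\<mu>) = ennreal (\<integral>x. h x \<partial>\<mu>)"
    by (intro nn AE_unit finite_measure_axioms) simp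
  finally show ?thesis
    using w v by (simp add: nonneg ennreal_inj flip: ennreal_mult ennreal_plus)
qed

end

section \<open>Squared distance to a finite set\<close>

definition sqdist :: "real set \<Rightarrow> real \<Rightarrow> real" where
  "sqdist A x = Min ((\<lambda>a. (x - a)\<^sup>2) ` A)"

text \<open>The truncation makes the empty set admissible and removes the influence of points far
  from a piece of the support.\<close>

definition trunc_sqdist :: "real set \<Rightarrow> real \<Rightarrow> real" where
  "trunc_sqdist A x = Min (insert (1/25) ((\<lambda>a. (x - a)\<^sup>2) ` A))"

lemma continuous_on_sqdist:
  assumes "finite A" "A \<noteq> {}"
  shows "continuous_on UNIV (sqdist A)"
  using assms
proof (induction rule: finite_ne_induct)
  case (singleton a)
  show ?case by (simp add: sqdist_def[abs_def] continuous_intros)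
next
  case (insert a A)
  then have "sqdist (insert a A) = (\<lambda>x. min ((x - a)\<^sup>2) (sqdist A x))"
    by (simp add: sqdist_def[abs_def])
  then show ?case using insert.IH by (auto intro!: continuous_intros)
qed

lemma continuous_on_trunc_sqdist:
  assumes "finite A"
  shows "continuous_on UNIV (trunc_sqdist A)"
proof (cases "A = {}")
  case True
  then show ?thesis by (simp add: trunc_sqdist_def[abs_def])
next
  case False
  with assms have "trunc_sqdist A = (\<lambda>x. min (1/25) (sqdist A x))"
    by (simp add: trunc_sqdist_def[abs_def] sqdist_def)
  then show ?thesis
    using continuous_on_sqdist[OF assms False] by (auto intro!: continuous_intros)
qed

lemma sqdist_nonneg: "finite A \<Longrightarrow> A \<noteq> {} \<Longrightarrow> 0 \<le> sqdist A x"
  by (simp add: sqdist_def)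

lemma trunc_sqdist_nonneg: "finite A \<Longrightarrow> 0 \<le> trunc_sqdist A x"
  by (simp add: trunc_sqdist_def)

lemma sqdist_antimono: "finite B \<Longrightarrow> A \<noteq> {} \<Longrightarrow> A \<subseteq> B \<Longrightarrow> sqdist B x \<le> sqdist A x"
  unfolding sqdist_def by (rule Min_antimono) auto

lemma trunc_sqdist_le: "finite A \<Longrightarrow> A \<noteq> {} \<Longrightarrow> trunc_sqdist A x \<le> sqdist A x"
  unfolding sqdist_def trunc_sqdist_def by (rule Min_antimono) auto

lemma sqdist_affine:
  assumes "finite A" "A \<noteq> {}"
  shows "sqdist ((\<lambda>a. r * a + s) ` A) (r * x + s) = r\<^sup>2 * sqdist A x"
proof -
  have "mono ((*) (r\<^sup>2))" by (auto intro!: monoI mult_left_mono)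
  then have "r\<^sup>2 * sqdist A x = Min ((*) (r\<^sup>2) ` (\<lambda>a. (x - a)\<^sup>2) ` A)"
    unfolding sqdist_def using assms by (intro mono_Min_commute) auto
  also have "(*) (r\<^sup>2) ` (\<lambda>a. (x - a)\<^sup>2) ` A = (\<lambda>a. (r * x + s - a)\<^sup>2) ` (\<lambda>a. r * a + s) ` A"
    unfolding image_image by (intro image_cong refl) (simp add: power2_eq_square algebra_simps)
  finally show ?thesis by (simp add: sqdist_def)
qed

text \<open>Pulling back a point of \<open>B\<close> multiplies its squared distance by exactly 25.
  Every other point of \<open>A\<close> is no closer than the cap \<open>1/25\<close> allows, and
  the left side never exceeds that cap, so such points may be dropped.\<close>

lemma trunc_sqdist_affine_ge:
  assumes "finite A" "finite B"
    and "\<And>a. a \<in> A \<Longrightarrow> a \<in> B \<or> 1/25 \<le> (1/5 * x + s - a)\<^sup>2"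
  shows "1/25 * trunc_sqdist ((\<lambda>a. 5 * (a - s)) ` B) x \<le> trunc_sqdist A (1/5 * x + s)"
proof -
  let ?B = "(\<lambda>a. 5 * (a - s)) ` B"
  have const: "trunc_sqdist ?B x \<le> 1/25"
    unfolding trunc_sqdist_def using assms(2) by (intro Min_le) auto
  have pt: "1/25 * trunc_sqdist ?B x \<le> (1/5 * x + s - a)\<^sup>2" if "a \<in> A" for a
  proof (cases "a \<in> B")
    case True
    then have "trunc_sqdist ?B x \<le> (x - 5 * (a - s))\<^sup>2"
      unfolding trunc_sqdist_def using assms(2) by (intro Min_le) auto
    also have "\<dots> = 25 * (1/5 * x + s - a)\<^sup>2"
      by (simp add: power2_eq_square algebra_simps)
    finally show ?thesis by simp
  next
    case False
    then show ?thesis using assms(3)[OF that] const by simp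
  qed
  show ?thesis
    unfolding trunc_sqdist_def[of A] using assms(1) pt const by (subst Min_ge_iff) auto
qed

text \<open>Each affine image of \<open>\<mu>\<close> is served by its own scaled copy of
  \<open>A\<close>, and \<open>\<rho>\<close> by \<open>B\<close>; the remaining points can only
  lower the distance.\<close>

lemma (in condensation) integral_sqdist_le:
  assumes A: "finite A" "A \<noteq> {}" and B: "finite B" "B \<noteq> {} \<or> v = 0"
  shows "(\<integral>x. sqdist ((\<lambda>a. r * a + s) ` A \<union> (\<lambda>a. r * a + t) ` A \<union> B) x \<partial>\<mu>)
    \<le> 2 * w * r\<^sup>2 * (\<integral>x. sqdist A x \<partial>\<mu>) + v * (\<integral>x. sqdist B x \<partial>\<rho>)"
proof -
  let ?U = "(\<lambda>a. r * a + s) ` A \<union> (\<lambda>a. r * a + t) ` A \<union> B"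
  have U: "finite ?U" "?U \<noteq> {}" using A B by auto
  note cont = continuous_on_sqdist[OF U]
  have piece: "(\<integral>x. sqdist ?U (r * x + u) \<partial>\<mu>) \<le> r\<^sup>2 * (\<integral>x. sqdist A x \<partial>\<mu>)"
    if u: "0 \<le> u" "u \<le> 1 - r" "(\<lambda>a. r * a + u) ` A \<subseteq> ?U" for u
  proof -
    have "(\<integral>x. sqdist ?U (r * x + u) \<partial>\<mu>) \<le> (\<integral>x. r\<^sup>2 * sqdist A x \<partial>\<mu>)"
    proof (rule integral_mono)
      show "integrable \<mu> (\<lambda>x. sqdist ?U (r * x + u))"
        by (rule integrable_unit[OF finite_measure_axioms AE_affine_unit[OF u(1,2)] _ cont]) simp
      show "integrable \<mu> (\<lambda>x. r\<^sup>2 * sqdist A x)"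
        by (intro integrable_mult_right integrable_unit[OF finite_measure_axioms AE_unit]
            continuous_on_sqdist A) simp
      show "sqdist ?U (r * x + u) \<le> r\<^sup>2 * sqdist A x" for x
        using sqdist_antimono[OF U(1) _ u(3)] A by (subst sqdist_affine[OF A, symmetric]) auto
    qed
    then show ?thesis by simp
  qed
  have "v * (\<integral>x. sqdist ?U x \<partial>\<rho>) \<le> v * (\<integral>x. sqdist B x \<partial>\<rho>)"
  \<comment> \<open>For \<open>v = 0\<close> both sides vanish. This case is separate because
    \<open>B\<close> may then be empty, and \<open>sqdist {}\<close> is a \<open>Min\<close> over
    the empty set.\<close>
  proof (cases "v = 0")
    case False
    with B have "B \<noteq> {}" by simp
    have "(\<integral>x. sqdist ?U x \<partial>\<rho>) \<le> (\<integral>x. sqdist B x \<partial>\<rho>)"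
    proof (rule integral_mono)
      show "integrable \<rho> (\<lambda>x. sqdist ?U x)" "integrable \<rho> (\<lambda>x. sqdist B x)"
        using \<open>B \<noteq> {}\<close> B(1) U
        by (auto intro!: integrable_unit[OF \<rho>.finite_measure_axioms condensed_unit] continuous_on_sqdist)
      show "sqdist ?U x \<le> sqdist B x" for x
        using \<open>B \<noteq> {}\<close> U(1) by (intro sqdist_antimono) auto
    qed
    then show ?thesis using v by (rule mult_left_mono)
  qed simp
  moreover have "w * (\<integral>x. sqdist ?U (r * x + s) \<partial>\<mu>) \<le> w * (r\<^sup>2 * (\<integral>x. sqdist A x \<partial>\<mu>))"
    using piece[of s] s w by (intro mult_left_mono) auto
  moreover have "w * (\<integral>x. sqdist ?U (r * x + t) \<partial>\<mu>) \<le> w * (r\<^sup>2 * (\<integral>x. sqdist A x \<partial>\<mu>))"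
    using piece[of t] t w by (intro mult_left_mono) auto
  ultimately show ?thesis
    using integral_self_similar[OF cont sqdist_nonneg[OF U]] by simp
qed

lemma (in condensation) integral_sqdist_0_le: "(\<integral>x. sqdist {0} x \<partial>\<mu>) \<le> 1"
proof (rule integral_le_const)
  show "integrable \<mu> (sqdist {0})"
    by (rule integrable_unit[OF finite_measure_axioms AE_unit]) (auto intro: continuous_on_sqdist)
  show "AE x in \<mu>. sqdist {0} x \<le> 1"
    using AE_unit by eventually_elim (auto simp: sqdist_def power_le_one)
qed

section \<open>Bounds for the quantization error\<close>

text \<open>Two copies of \<open>A\<close> at scale 1/7 double the number of points and multiply the
  error by \<open>2 * (1/2) * (1/7)\<^sup>2 = 1/49\<close>.\<close>

lemma self_similar_upper:
  assumes "condensation \<nu> \<rho> (1/7) s t (1/2) 0"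
  shows "\<exists>A. finite A \<and> A \<noteq> {} \<and> card A \<le> 2 ^ k \<and> (\<integral>x. sqdist A x \<partial>\<nu>) \<le> (1/49) ^ k"
proof (induction k)
  interpret condensation \<nu> \<rho> "1/7" s t "1/2" 0 by fact
  case 0
  show ?case using integral_sqdist_0_le by (intro exI[of _ "{0}"]) auto
next
  interpret condensation \<nu> \<rho> "1/7" s t "1/2" 0 by fact
  case (Suc k)
  then obtain A where A: "finite A" "A \<noteq> {}" "card A \<le> 2 ^ k" "(\<integral>x. sqdist A x \<partial>\<nu>) \<le> (1/49) ^ k"
    by blast
  let ?U = "(\<lambda>a. 1/7 * a + s) ` A \<union> (\<lambda>a. 1/7 * a + t) ` A"
  have "card ?U \<le> card A + card A"
    using card_Un_le card_image_le[OF A(1)] by (meson add_mono order_trans)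
  moreover have "(\<integral>x. sqdist ?U x \<partial>\<nu>) \<le> 1/49 * (1/49) ^ k"
    using integral_sqdist_le[OF A(1,2), of "{}"] A(4) by (simp add: power2_eq_square)
  ultimately show ?case
    using A by (intro exI[of _ ?U]) auto
qed

text \<open>The errors obey a recurrence with factor \<open>2/75\<close> and forcing term
  \<open>1/3 * (1/49) ^ Suc m\<close>. The subtracted multiple of \<open>(1/49) ^ m\<close> absorbs
  the forcing, and \<open>3 - 2 = 1\<close> matches the start.\<close>

lemma condensation_upper:
  assumes "condensation P \<nu> (1/5) 0 (4/5) (1/3) (1/3)" "condensation \<nu> \<rho> (1/7) s t (1/2) 0"
  shows "\<exists>A. finite A \<and> A \<noteq> {} \<and> card A \<le> (m + 1) * 2 ^ m \<and>
    (\<integral>x. sqdist A x \<partial>P) \<le> 3 * (2/75) ^ m - 2 * (1/49) ^ m"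
proof (induction m)
  interpret condensation P \<nu> "1/5" 0 "4/5" "1/3" "1/3" by fact
  case 0
  show ?case using integral_sqdist_0_le by (intro exI[of _ "{0}"]) auto
next
  interpret condensation P \<nu> "1/5" 0 "4/5" "1/3" "1/3" by fact
  case (Suc m)
  then obtain A where A: "finite A" "A \<noteq> {}" "card A \<le> (m + 1) * 2 ^ m"
      "(\<integral>x. sqdist A x \<partial>P) \<le> 3 * (2/75) ^ m - 2 * (1/49) ^ m"
    by blast
  obtain B where B: "finite B" "B \<noteq> {}" "card B \<le> 2 ^ Suc m" "(\<integral>x. sqdist B x \<partial>\<nu>) \<le> (1/49) ^ Suc m"
    using self_similar_upper[OF assms(2)] by blast
  let ?U = "(\<lambda>a. 1/5 * a + 0) ` A \<union> (\<lambda>a. 1/5 * a + 4/5) ` A \<union> B"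
  have "card ?U \<le> card A + card A + card B"
    using card_Un_le card_image_le[OF A(1)] by (meson add_mono order_trans order_refl)
  also have "\<dots> \<le> (Suc m + 1) * 2 ^ Suc m"
    using A(3) B(3) by (simp add: algebra_simps)
  finally have "card ?U \<le> (Suc m + 1) * 2 ^ Suc m" .
  moreover have "(\<integral>x. sqdist ?U x \<partial>P) \<le> 3 * (2/75) ^ Suc m - 2 * (1/49) ^ Suc m"
  proof -
    have "(\<integral>x. sqdist ?U x \<partial>P) \<le> 2/75 * (\<integral>x. sqdist A x \<partial>P) + 1/3 * (\<integral>x. sqdist B x \<partial>\<nu>)"
      using integral_sqdist_le[OF A(1,2), of B] B(1,2) by (simp add: power2_eq_square)
    also have "\<dots> \<le> 2/75 * (3 * (2/75) ^ m - 2 * (1/49) ^ m) + 1/3 * (1/49) ^ Suc m"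
      using A(4) B(4) by (intro add_mono mult_left_mono) auto
    \<comment> \<open>After cancellation this is \<open>1/147 \<le> 2 * (2/75 - 1/49)\<close>, where
      \<open>1/49 < 2/75\<close> enters.\<close>
    also have "\<dots> \<le> 3 * (2/75) ^ Suc m - 2 * (1/49) ^ Suc m"
      by (simp add: algebra_simps)
    finally show ?thesis .
  qed
  ultimately show ?case
    using A B by (intro exI[of _ ?U]) auto
qed

text \<open>The deficit \<open>2 ^ m - card A\<close> is additive over the split of
  \<open>A\<close>, and each level costs the factor \<open>1/3 * 1/25 = 1/75\<close>. The deficit is
  real and may be negative, so an uneven split does no harm.\<close>

lemma condensation_lower:
  assumes "condensation P \<nu> (1/5) 0 (4/5) (1/3) (1/3)" "finite A"
  shows "1/25 * (1/75) ^ m * (2 ^ m - real (card A)) \<le> (\<integral>x. trunc_sqdist A x \<partial>P)"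
  using assms(2)
proof (induction m arbitrary: A)
  interpret condensation P \<nu> "1/5" 0 "4/5" "1/3" "1/3" by fact
  case 0
  show ?case
  \<comment> \<open>With no points the integrand is the constant cap \<open>1/25\<close>; with at
    least one point the left side is at most 0.\<close>
  proof (cases "A = {}")
    case True
    then show ?thesis using prob_space by (simp add: trunc_sqdist_def)
  next
    case False
    then have "1 \<le> card A" using 0 by (simp add: Suc_leI card_gt_0_iff)
    moreover have "0 \<le> (\<integral>x. trunc_sqdist A x \<partial>P)"
      by (simp add: trunc_sqdist_nonneg 0)
    ultimately show ?thesis by simp
  qed
next
  interpret condensation P \<nu> "1/5" 0 "4/5" "1/3" "1/3" by fact
  case (Suc m)
  \<comment> \<open>The images of the unit interval are \<open>{0..1/5}\<close> and
    \<open>{4/5..1}\<close>, so a point on the wrong side of 1/2 is at distance at least 3/10 from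
    the image, beyond the cap distance 1/5.\<close>
  define L R where "L = {a \<in> A. a \<le> 1/2}" and "R = {a \<in> A. a > 1/2}"
  have fin: "finite L" "finite R" using Suc.prems by (auto simp: L_def R_def)
  have "card A = card (L \<union> R)" by (rule arg_cong[where f=card]) (auto simp: L_def R_def)
  also have "\<dots> = card L + card R"
    using fin by (intro card_Un_disjoint) (auto simp: L_def R_def)
  finally have card: "card A = card L + card R" .
  have piece: "1/25 * (1/25 * (1/75) ^ m * (2 ^ m - real (card B)))
      \<le> (\<integral>x. trunc_sqdist A (1/5 * x + u) \<partial>P)"
    if u: "0 \<le> u" "u \<le> 1 - 1/5" and B: "finite B"
      and far: "\<And>x a. x \<in> {0..1} \<Longrightarrow> a \<in> A \<Longrightarrow> a \<notin> B \<Longrightarrow> 1/5 \<le> \<bar>1/5 * x + u - a\<bar>" for u B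
  proof -
    let ?B = "(\<lambda>a. 5 * (a - u)) ` B"
    have "card ?B = card B" by (intro card_image) (auto simp: inj_on_def)
    then have "1/25 * (1/25 * (1/75) ^ m * (2 ^ m - real (card B)))
        \<le> 1/25 * (\<integral>x. trunc_sqdist ?B x \<partial>P)"
      using Suc.IH[of ?B] B by (simp add: mult.commute)
    also have "\<dots> = (\<integral>x. 1/25 * trunc_sqdist ?B x \<partial>P)" by simp
    also have "\<dots> \<le> (\<integral>x. trunc_sqdist A (1/5 * x + u) \<partial>P)"
    proof (rule integral_mono_AE)
      show "integrable P (\<lambda>x. 1/25 * trunc_sqdist ?B x)"
        using B by (intro integrable_mult_right integrable_unit[OF finite_measure_axioms AE_unit]
            continuous_on_trunc_sqdist) auto
      show "integrable P (\<lambda>x. trunc_sqdist A (1/5 * x + u))"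
        by (rule integrable_unit[OF finite_measure_axioms AE_affine_unit[OF u]])
          (simp_all add: continuous_on_trunc_sqdist Suc.prems)
      show "AE x in P. 1/25 * trunc_sqdist ?B x \<le> trunc_sqdist A (1/5 * x + u)"
        using AE_unit
      proof eventually_elim
        case (elim x)
        have "1/25 \<le> (1/5 * x + u - a)\<^sup>2" if "a \<in> A" "a \<notin> B" for a
          using power_mono[OF far[OF elim that], of 2] by (simp add: power2_eq_square)
        then show ?case by (intro trunc_sqdist_affine_ge Suc.prems B) auto
      qed
    qed
    finally show ?thesis .
  qed
  have "1/25 * (1/25 * (1/75) ^ m * (2 ^ m - real (card L))) \<le> (\<integral>x. trunc_sqdist A (1/5 * x + 0) \<partial>P)"
    by (rule piece) (use fin in \<open>auto simp: L_def\<close>)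
  moreover have "1/25 * (1/25 * (1/75) ^ m * (2 ^ m - real (card R)))
      \<le> (\<integral>x. trunc_sqdist A (1/5 * x + 4/5) \<partial>P)"
    by (rule piece) (use fin in \<open>auto simp: R_def\<close>)
  moreover have "0 \<le> (\<integral>x. trunc_sqdist A x \<partial>\<nu>)"
    by (simp add: trunc_sqdist_nonneg Suc.prems)
  moreover have "1/25 * (1/75) ^ Suc m * (2 ^ Suc m - real (card A))
      = 1/3 * (1/25 * (1/25 * (1/75) ^ m * (2 ^ m - real (card L))))
        + 1/3 * (1/25 * (1/25 * (1/75) ^ m * (2 ^ m - real (card R))))"
    by (simp add: card algebra_simps add_divide_distrib diff_divide_distrib)
  ultimately show ?case
    using integral_self_similar[OF continuous_on_trunc_sqdist trunc_sqdist_nonneg, OF Suc.prems Suc.prems]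
    by linarith
qed

section \<open>From finite sets to the infimum\<close>

lemma quantization_error_le:
  assumes "finite A" "A \<noteq> {}" "card A \<le> n"
  shows "quantization_error \<mu> n \<le> (\<integral>x. sqdist A x \<partial>\<mu>)"
  unfolding quantization_error_def sqdist_def
proof (rule cInf_lower)
  show "bdd_below {(\<integral>x. Min ((\<lambda>a. (x - a)\<^sup>2) ` \<alpha>) \<partial>\<mu>) | \<alpha>. finite \<alpha> \<and> 1 \<le> card \<alpha> \<and> card \<alpha> \<le> n}"
    by (rule bdd_belowI[of _ 0]) (auto simp: card_gt_0_iff Suc_le_eq 
        intro!: Bochner_Integration.integral_nonneg sqdist_nonneg[unfolded sqdist_def])
qed (use assms in \<open>auto simp: Suc_le_eq card_gt_0_iff\<close>)

lemma quantization_error_ge: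
  assumes "1 \<le> n"
    and "\<And>A. finite A \<Longrightarrow> A \<noteq> {} \<Longrightarrow> card A \<le> n \<Longrightarrow> b \<le> (\<integral>x. sqdist A x \<partial>\<mu>)"
  shows "b \<le> quantization_error \<mu> n"
  unfolding quantization_error_def
proof (rule cInf_greatest)
  show "{(\<integral>x. Min ((\<lambda>a. (x - a)\<^sup>2) ` \<alpha>) \<partial>\<mu>) | \<alpha>. finite \<alpha> \<and> 1 \<le> card \<alpha> \<and> card \<alpha> \<le> n} \<noteq> {}"
    using assms(1) by (auto intro!: exI[of _ "{0}"])
qed (use assms(2) in \<open>auto simp: Suc_le_eq card_gt_0_iff sqdist_def\<close>)

section \<open>The quantization dimension\<close>

text \<open>With \<open>x\<close> the binary logarithm of \<open>n\<close>, the lower bound is used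
  at \<open>m\<close> near \<open>x + 1\<close> and the upper bound at \<open>m\<close> near
  \<open>x - log 2 (x + 1)\<close>. Both give \<open>- ln (V n)\<close> asymptotic to
  \<open>x * L\<close>, since the logarithmic correction is negligible against
  \<open>x\<close>.\<close>

lemma log_quotient_limit:
  fixes V :: "nat \<Rightarrow> real"
  assumes lower: "\<And>m n. 1 \<le> n \<Longrightarrow> 1/25 * (1/75) ^ m * (2 ^ m - real n) \<le> V n"
    and upper: "\<And>m n. (m + 1) * 2 ^ m \<le> n \<Longrightarrow> V n \<le> 3 * (2/75) ^ m"
  shows "(\<lambda>n. 2 * ln (real n) / (- ln (V n))) \<longlonglongrightarrow> 2 * ln 2 / (ln 75 - ln 2)"
proof -
  define L l :: real where "L = ln 75 - ln 2" and "l = ln 2"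
  have pos: "L > 0" "l > 0" by (simp_all add: L_def l_def)
  have ln_pow: "ln ((2/75) ^ m) = - (real m * L)" for m :: nat
    by (simp add: ln_realpow ln_div L_def algebra_simps)
  define x where "x n = ln (real n) / l" for n :: nat
  define f g where "f n = (x n + 2) * L + ln 50"
    and "g n = (x n - ln (x n + 1) / l - 1) * L - ln 3" for n
  have x: "real n = 2 powr x n" "0 \<le> x n" if "1 \<le> n" for n
    using that by (auto simp: x_def l_def powr_def)
  \<comment> \<open>If \<open>2 * n \<le> 2 ^ m\<close>, at least half of \<open>2 ^ m\<close>
    survives in the deficit, whence \<open>50 = 2 * 25\<close>.\<close>
  have half: "(2/75) ^ m / 50 \<le> V n" if "1 \<le> n" "2 * n \<le> 2 ^ m" for m n
  proof -
    have "2 * real n \<le> 2 ^ m" using that(2) by (metis of_nat_le_iff of_nat_mult of_nat_numeral of_nat_power)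
    then have "1/25 * (1/75) ^ m * (2 ^ m / 2) \<le> 1/25 * (1/75) ^ m * (2 ^ m - real n)"
      by (intro mult_left_mono) auto
    with lower[OF that(1), of m] show ?thesis by (simp add: power_divide)
  qed
  have f: "0 < V n" "- ln (V n) \<le> f n" if n: "1 \<le> n" for n
  proof -
    define m where "m = nat \<lceil>x n\<rceil> + 1"
    have m: "x n + 1 \<le> real m" "real m \<le> x n + 2" using x(2)[OF n] by (auto simp: m_def; linarith)+
    have "2 * real n = 2 powr (x n + 1)" using x(1)[OF n] by (simp add: powr_add)
    also have "\<dots> \<le> 2 powr real m" using m by simp
    finally have "real (2 * n) \<le> real (2 ^ m)" by (simp add: powr_realpow)
    then have V: "(2/75) ^ m / 50 \<le> V n" using half[OF n] of_nat_le_iff by blast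
    moreover have "0 < (2/75 :: real) ^ m / 50" by simp
    ultimately show "0 < V n" by linarith
    have "ln ((2/75) ^ m / 50) \<le> ln (V n)" using V by (intro ln_mono) auto
    then have "- ln (V n) \<le> real m * L + ln 50" by (simp add: ln_div ln_pow)
    also have "\<dots> \<le> f n" using m pos by (simp add: f_def)
    finally show "- ln (V n) \<le> f n" .
  qed
  have g: "g n \<le> - ln (V n)" if n: "1 \<le> n" for n
  proof -
    \<comment> \<open>Chosen so that \<open>(x n + 1) * 2 powr y = n\<close>; rounding down then
      makes \<open>(m + 1) * 2 ^ m\<close> fit below \<open>n\<close>. For negative
      \<open>y\<close>, \<open>nat\<close> gives \<open>m = 0\<close> and the requirement is
      \<open>1 \<le> n\<close>.\<close>
    define y where "y = x n - ln (x n + 1) / l"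
    define m where "m = nat \<lfloor>y\<rfloor>"
    have "(m + 1) * 2 ^ m \<le> n"
    proof (cases "0 \<le> y")
      case True
      have "0 \<le> ln (x n + 1) / l" using x(2)[OF n] pos by simp
      then have m: "real m \<le> y" "real m \<le> x n" using True by (auto simp: m_def y_def; linarith)+
      have "real ((m + 1) * 2 ^ m) = (real m + 1) * 2 powr real m"
        by (simp add: powr_realpow algebra_simps)
      also have "\<dots> \<le> (x n + 1) * 2 powr y" using m by (intro mult_mono) auto
      also have "2 powr y = 2 powr x n / (x n + 1)"
        using x(2)[OF n] pos by (simp add: y_def powr_diff) (simp add: powr_def l_def)
      also have "(x n + 1) * \<dots> = real n" using x[OF n] by simp
      finally show ?thesis using of_nat_le_iff by blast
    next
      case False
      then show ?thesis using n by (simp add: m_def)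
    qed
    then have "ln (V n) \<le> ln (3 * (2/75) ^ m)" using f(1)[OF n] by (intro ln_mono upper)
    then have "real m * L - ln 3 \<le> - ln (V n)" by (simp add: ln_mult ln_pow)
    moreover have "(y - 1) * L \<le> real m * L" using pos by (intro mult_right_mono) (auto simp: m_def; linarith)+
    ultimately show ?thesis by (simp add: g_def y_def)
  qed
  \<comment> \<open>Positivity of \<open>g n\<close> makes all denominators positive, so that taking
    quotients reverses the bounds on \<open>- ln (V n)\<close>.\<close>
  have ev: "eventually (\<lambda>n. 1 \<le> n \<and> 0 < g n) sequentially"
    unfolding g_def x_def using pos by (intro eventually_conj eventually_ge_at_top) real_asymp
  show ?thesis
  proof (rule tendsto_sandwich)
    show "eventually (\<lambda>n. 2 * ln (real n) / f n \<le> 2 * ln (real n) / (- ln (V n))) sequentially"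
      using ev
    proof eventually_elim
      case (elim n)
      then have "0 < - ln (V n)" using g[of n] by linarith
      then show ?case using f(2)[of n] elim by (intro divide_left_mono mult_pos_pos) auto
    qed
    show "eventually (\<lambda>n. 2 * ln (real n) / (- ln (V n)) \<le> 2 * ln (real n) / g n) sequentially"
      using ev
    proof eventually_elim
      case (elim n)
      then have "0 < - ln (V n)" using g[of n] by linarith
      then show ?case using g[of n] elim by (intro divide_left_mono mult_pos_pos) auto
    qed
    have "(\<lambda>n. 2 * ln (real n) / f n) \<longlonglongrightarrow> 2 * l / L"
      unfolding f_def x_def using pos by (real_asymp simp: field_simps)
    then show "(\<lambda>n. 2 * ln (real n) / f n) \<longlonglongrightarrow> 2 * ln 2 / (ln 75 - ln 2)"
      by (simp add: L_def l_def)
    have "(\<lambda>n. 2 * ln (real n) / g n) \<longlonglongrightarrow> 2 * l / L"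
      unfolding g_def x_def using pos by (real_asymp simp: field_simps)
    then show "(\<lambda>n. 2 * ln (real n) / g n) \<longlonglongrightarrow> 2 * ln 2 / (ln 75 - ln 2)"
      by (simp add: L_def l_def)
  qed
qed

text \<open>The base is 1/75, so taking logarithms leaves an equation that is linear in
  \<open>k\<close> once the denominator is cleared.\<close>

lemma powr_eq_half_iff:
  "(1/3 * (1/5)\<^sup>2) powr (k / (2 + k)) = (1/2::real) \<longleftrightarrow> k = 2 * ln 2 / (ln 75 - ln 2)"
proof -
  have "(1/3 * (1/5)\<^sup>2) powr (k / (2 + k)) = exp (- (k / (2 + k) * ln 75))"
    by (simp add: powr_def power2_eq_square ln_div)
  moreover have "(1/2::real) = exp (- ln 2)" by (simp add: exp_minus)
  ultimately have "(1/3 * (1/5)\<^sup>2) powr (k / (2 + k)) = (1/2::real) \<longleftrightarrow> k / (2 + k) * ln 75 = ln 2"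
    by (metis exp_inj_iff neg_equal_iff_equal)
  also have "\<dots> \<longleftrightarrow> k * (ln 75 - ln 2) = 2 * ln 2"
  proof (cases "2 + k = 0")
    \<comment> \<open>Division by zero makes the quotient 0, so the left equation reads
      \<open>0 = ln 2\<close>, while the right one would force \<open>ln 75 = 0\<close>; both
      fail.\<close>
    case True
    then have k: "k = -2" by simp
    have "0 < ln (75::real)" "0 < ln (2::real)" by simp_all
    then show ?thesis by (simp add: k)
  next
    case False
    then show ?thesis by (simp add: field_simps)
  qed
  also have "\<dots> \<longleftrightarrow> k = 2 * ln 2 / (ln 75 - ln 2)"
    by (simp add: field_simps)
  finally show ?thesis .
qed

theorem theorem4p4p1:
  fixes P \<nu> :: "real measure" and \<kappa> :: real
  assumes "compactly_supported_distribution \<nu>"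
    and "\<And>A. A \<in> sets borel \<Longrightarrow>
           measure \<nu> A = 1/2 * measure (distr \<nu> borel T1) A + 1/2 * measure (distr \<nu> borel T2) A"
    and "compactly_supported_distribution P"
    and "\<And>A. A \<in> sets borel \<Longrightarrow>
           measure P A = 1/3 * measure (distr P borel S1) A + 1/3 * measure (distr P borel S2) A
                         + 1/3 * measure \<nu> A"
    and "\<kappa> = 2 * ln 2 / (ln 75 - ln 2)"
  shows "(\<forall>k::real. (1/3 * (1/5)\<^sup>2) powr (k / (2 + k)) = (1/2::real) \<longleftrightarrow> k = \<kappa>)
         \<and> quantization_quotient P \<longlonglongrightarrow> \<kappa>
         \<and> quantization_dimension P = \<kappa>"
proof -
  interpret \<nu>: real_distribution \<nu>
    using assms(1) by (simp add: compactly_supported_distribution_def)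
  interpret P: real_distribution P
    using assms(3) by (simp add: compactly_supported_distribution_def)
  interpret Z: real_distribution "return borel (0::real)"
    by (simp add: real_distribution_def real_distribution_axioms_def prob_space_return)
  have maps: "T1 = (\<lambda>x. 1/7 * x + 12/35)" "T2 = (\<lambda>x. 1/7 * x + 18/35)"
    "S1 = (\<lambda>x. 1/5 * x + 0)" "S2 = (\<lambda>x. 1/5 * x + 4/5)"
    by (auto simp: T1_def T2_def S1_def S2_def)
  \<comment> \<open>The condensed measure has weight 0 here; a point mass at 0 fills its place,
    being concentrated on the unit interval.\<close>
  interpret \<nu>: condensation \<nu> "return borel 0" "1/7" "12/35" "18/35" "1/2" 0
    using assms(1) assms(2)[unfolded maps]
    by unfold_locales (simp_all add: compactly_supported_distribution_def AE_return)
  \<comment> \<open>The preceding interpretation supplies \<open>\<nu>.AE_unit\<close>, which is the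
    requirement on the condensed measure of \<open>P\<close>.\<close>
  interpret P: condensation P \<nu> "1/5" 0 "4/5" "1/3" "1/3"
    using assms(3) assms(4)[unfolded maps] \<nu>.AE_unit
    by unfold_locales (simp_all add: compactly_supported_distribution_def)
  have "quantization_quotient P \<longlonglongrightarrow> \<kappa>"
    unfolding quantization_quotient_def[abs_def] assms(5)
  proof (rule log_quotient_limit)
    fix m n :: nat
    show "1/25 * (1/75) ^ m * (2 ^ m - real n) \<le> quantization_error P n" if "1 \<le> n"
    proof (rule quantization_error_ge[OF that])
      fix A :: "real set"
      assume A: "finite A" "A \<noteq> {}" "card A \<le> n"
      have "1/25 * (1/75) ^ m * (2 ^ m - real n) \<le> 1/25 * (1/75) ^ m * (2 ^ m - real (card A))"
        using A(3) by (intro mult_left_mono) auto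
      also have "\<dots> \<le> (\<integral>x. trunc_sqdist A x \<partial>P)"
        by (rule condensation_lower[OF P.condensation_axioms A(1)])
      also have "\<dots> \<le> (\<integral>x. sqdist A x \<partial>P)"
        using A by (intro integral_mono trunc_sqdist_le
            integrable_unit[OF P.finite_measure_axioms P.AE_unit]
            continuous_on_sqdist continuous_on_trunc_sqdist) simp_all
      finally show "1/25 * (1/75) ^ m * (2 ^ m - real n) \<le> (\<integral>x. sqdist A x \<partial>P)" .
    qed
    show "quantization_error P n \<le> 3 * (2/75) ^ m" if n: "(m + 1) * 2 ^ m \<le> n"
    proof -
      obtain A where A: "finite A" "A \<noteq> {}" "card A \<le> (m + 1) * 2 ^ m"
          "(\<integral>x. sqdist A x \<partial>P) \<le> 3 * (2/75) ^ m - 2 * (1/49) ^ m"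
        using condensation_upper[OF P.condensation_axioms \<nu>.condensation_axioms] by blast
      have "quantization_error P n \<le> (\<integral>x. sqdist A x \<partial>P)"
        using A n by (intro quantization_error_le) auto
      also have "\<dots> \<le> 3 * (2/75) ^ m"
        using A(4) zero_le_power[of "1/49::real" m] by linarith
      finally show ?thesis .
    qed
  qed
  then show ?thesis
    using powr_eq_half_iff assms(5) by (simp add: quantization_dimension_def limI)
qed

end
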